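(* Let $G$ be a finite group with $q=|G|$ and let $2\le k\le q$. Then $$g_G(W(q,k))\le k-1.$$
   Context: The $k$-wise maximum diagonal is $$\Delta'^{\,k}_q(\mathbb R)=\{(y_1,\dots,y_q)\in\mathbb R^q:\ y_{i_1}=\dots=y_{i_k}=c\text{ for some } i_1<\dots<i_k\text{ and } c\in\mathbb R,\text{ and } y_j\le c\ \forall j\},$$ and $W(q,k)=\mathbb R^q\setminus\Delta'^{\,k}_q(\mathbb R)$. For a finite group $G$ with $|G|=q$, the power $Y^q$ is identified (via a bijection of $G$ with the index set) with the space $\mathrm{Map}(G,Y)$ of all maps $G\to Y$, with the left $G$-action $(g\phi)(h)=\phi(g^{-1}h)$; $W(q,k)$ is a $G$-invariant subspace of $\mathrm{Map}(G,\mathbb R)$. A $G$-space is fixed point free if no point is fixed by all of $G$. Let $D_G$ be the (discrete) disjoint union of all orbits $G/H$ over subgroups $H\ne G$. The fixed point free genus $g_G(X)$ of a fixed point free $G$-space $X$ is the least $n\ge0$ such that $X$ can be covered by $n$ ($G$-invariant) open subsets $X_1,\dots,X_n$, each admitting a $G$-equivariant continuous map $X_i\to D_G$ ($\infty$ if there is no such $n$; the empty space has genus $0$). *)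

theory Defs
  imports "HOL-Analysis.Analysis" "HOL-Algebra.Group_Action" "HOL-Algebra.Left_Coset" "HOL-Library.Extended_Nat"
begin

section \<open>The k-wise maximum diagonal and its complement\<close>

text \<open>Points of the q-fold power of the reals are the extensional functions on
  \<open>{1..q}\<close>, i.e. the points of \<open>powertop_real {1..q}\<close>. The indices
  i_1 < ... < i_k are given as the k-element set \<open>S\<close>.\<close>

definition max_diagonal :: "nat \<Rightarrow> nat \<Rightarrow> (nat \<Rightarrow> real) set" where
  "max_diagonal q k =
     {y \<in> {1..q} \<rightarrow>\<^sub>E (UNIV :: real set).
        \<exists>S c. S \<subseteq> {1..q} \<and> card S = k \<and> (\<forall>i\<in>S. y i = c) \<and> (\<forall>j\<in>{1..q}. y j \<le> c)}"

definition W :: "nat \<Rightarrow> nat \<Rightarrow> (nat \<Rightarrow> real) set" where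
  "W q k = ({1..q} \<rightarrow>\<^sub>E UNIV) - max_diagonal q k"


section \<open>G-spaces for a discrete group G\<close>

text \<open>\<open>group_action\<close> requires each \<open>a g\<close> to be extensional on the
  underlying set, hence the restrictions in the concrete actions below.\<close>

definition G_space :: "('g, 'm) monoid_scheme \<Rightarrow> 'x topology \<Rightarrow> ('g \<Rightarrow> 'x \<Rightarrow> 'x) \<Rightarrow> bool" where
  "G_space G X a \<longleftrightarrow>
     group_action G (topspace X) a \<and> (\<forall>g\<in>carrier G. continuous_map X X (a g))"

definition fixed_point_free ::
  "('g, 'm) monoid_scheme \<Rightarrow> 'x topology \<Rightarrow> ('g \<Rightarrow> 'x \<Rightarrow> 'x) \<Rightarrow> bool" where
  "fixed_point_free G X a \<longleftrightarrow> \<not> (\<exists>x\<in>topspace X. \<forall>g\<in>carrier G. a g x = x)"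

definition G_invariant ::
  "('g, 'm) monoid_scheme \<Rightarrow> ('g \<Rightarrow> 'x \<Rightarrow> 'x) \<Rightarrow> 'x set \<Rightarrow> bool" where
  "G_invariant G a U \<longleftrightarrow> (\<forall>g\<in>carrier G. a g ` U \<subseteq> U)"

definition equivariant_map ::
  "('g, 'm) monoid_scheme \<Rightarrow> 'x topology \<Rightarrow> ('g \<Rightarrow> 'x \<Rightarrow> 'x)
     \<Rightarrow> 'y topology \<Rightarrow> ('g \<Rightarrow> 'y \<Rightarrow> 'y) \<Rightarrow> ('x \<Rightarrow> 'y) \<Rightarrow> bool" where
  "equivariant_map G X a Y b f \<longleftrightarrow>
     continuous_map X Y f \<and> (\<forall>g\<in>carrier G. \<forall>x\<in>topspace X. f (a g x) = b g (f x))"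


section \<open>The disjoint union of the proper orbits\<close>

text \<open>The point \<open>(H, C)\<close> is the left coset \<open>C\<close> in the summand G/H.\<close>

definition D_points :: "('g, 'm) monoid_scheme \<Rightarrow> ('g set \<times> 'g set) set" where
  "D_points G = (SIGMA H : {H. subgroup H G \<and> H \<noteq> carrier G}. lcosets\<^bsub>G\<^esub> H)"

definition D_space :: "('g, 'm) monoid_scheme \<Rightarrow> ('g set \<times> 'g set) topology" where
  "D_space G = discrete_topology (D_points G)"

definition D_action ::
  "('g, 'm) monoid_scheme \<Rightarrow> 'g \<Rightarrow> 'g set \<times> 'g set \<Rightarrow> 'g set \<times> 'g set" where
  "D_action G = (\<lambda>g. \<lambda>p \<in> D_points G. (fst p, g <#\<^bsub>G\<^esub> snd p))"


section \<open>The fixed point free genus\<close>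

definition genus_cover ::
  "('g, 'm) monoid_scheme \<Rightarrow> 'x topology \<Rightarrow> ('g \<Rightarrow> 'x \<Rightarrow> 'x) \<Rightarrow> nat \<Rightarrow> bool" where
  "genus_cover G X a n \<longleftrightarrow>
     (\<exists>U :: nat \<Rightarrow> 'x set.
        (\<Union>i\<in>{1..n}. U i) = topspace X \<and>
        (\<forall>i\<in>{1..n}. openin X (U i) \<and> G_invariant G a (U i) \<and>
           (\<exists>f. equivariant_map G (subtopology X (U i)) a (D_space G) (D_action G) f)))"

text \<open>In \<open>enat\<close> the infimum of the empty set is \<open>\<infinity>\<close>.\<close>

definition fpf_genus ::
  "('g, 'm) monoid_scheme \<Rightarrow> 'x topology \<Rightarrow> ('g \<Rightarrow> 'x \<Rightarrow> 'x) \<Rightarrow> enat" where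
  "fpf_genus G X a = Inf {enat n |n. genus_cover G X a n}"


section \<open>The complement of the diagonal as a G-space\<close>

text \<open>Map(G, reals) is \<open>powertop_real (carrier G)\<close>. The bijection \<open>e\<close>
  from \<open>{1..q}\<close> to \<open>carrier G\<close> identifies it with \<open>powertop_real {1..q}\<close>.\<close>

definition W_space ::
  "('g, 'm) monoid_scheme \<Rightarrow> (nat \<Rightarrow> 'g) \<Rightarrow> nat \<Rightarrow> nat \<Rightarrow> ('g \<Rightarrow> real) topology" where
  "W_space G e q k =
     subtopology (powertop_real (carrier G)) {\<phi>. compose {1..q} \<phi> e \<in> W q k}"

definition Map_action ::
  "('g, 'm) monoid_scheme \<Rightarrow> ('g \<Rightarrow> real) set \<Rightarrow> 'g \<Rightarrow> ('g \<Rightarrow> real) \<Rightarrow> 'g \<Rightarrow> real" where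
  "Map_action G E = (\<lambda>g. \<lambda>\<phi>\<in>E. \<lambda>h\<in>carrier G. \<phi> (inv\<^bsub>G\<^esub> g \<otimes>\<^bsub>G\<^esub> h))"

abbreviation W_action ::
  "('g, 'm) monoid_scheme \<Rightarrow> (nat \<Rightarrow> 'g) \<Rightarrow> nat \<Rightarrow> nat \<Rightarrow> 'g \<Rightarrow> ('g \<Rightarrow> real) \<Rightarrow> 'g \<Rightarrow> real" where
  "W_action G e q k \<equiv> Map_action G (topspace (W_space G e q k))"


section \<open>These are fixed point free G-spaces\<close>

lemma group_actionI:
  assumes G: "group G"
    and ext: "\<And>g. g \<in> carrier G \<Longrightarrow> a g \<in> extensional E"
    and cl: "\<And>g x. g \<in> carrier G \<Longrightarrow> x \<in> E \<Longrightarrow> a g x \<in> E"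
    and one: "\<And>x. x \<in> E \<Longrightarrow> a \<one>\<^bsub>G\<^esub> x = x"
    and mult: "\<And>g h x. g \<in> carrier G \<Longrightarrow> h \<in> carrier G \<Longrightarrow> x \<in> E
                 \<Longrightarrow> a (g \<otimes>\<^bsub>G\<^esub> h) x = a g (a h x)"
  shows "group_action G E a"
proof -
  interpret group G by (rule G)
  have bij: "a g \<in> Bij E" if g: "g \<in> carrier G" for g
  proof -
    have "bij_betw (a g) E E"
    proof (rule bij_betwI[where g = "a (inv\<^bsub>G\<^esub> g)"])
      show "a g \<in> E \<rightarrow> E" "a (inv\<^bsub>G\<^esub> g) \<in> E \<rightarrow> E"
        using cl g by auto
      show "a (inv\<^bsub>G\<^esub> g) (a g x) = x" if "x \<in> E" for x
        using mult[of "inv\<^bsub>G\<^esub> g" g x] one that g by simp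
      show "a g (a (inv\<^bsub>G\<^esub> g) x) = x" if "x \<in> E" for x
        using mult[of g "inv\<^bsub>G\<^esub> g" x] one that g by simp
    qed
    then show ?thesis using ext g by (simp add: Bij_def)
  qed
  have "a (g \<otimes>\<^bsub>G\<^esub> h) = compose E (a g) (a h)"
    if "g \<in> carrier G" "h \<in> carrier G" for g h
    by (rule extensionalityI[of _ E]) (use ext mult that in \<open>auto simp: compose_def\<close>)
  then have "a \<in> hom G (BijGroup E)"
    using bij by (auto simp: hom_def BijGroup_def)
  then show ?thesis
    by (intro group_action.intro group_hom.intro group_hom_axioms.intro G group_BijGroup)
qed

lemma D_G_space:
  assumes "group G"
  shows "G_space G (D_space G) (D_action G)" "fixed_point_free G (D_space G) (D_action G)"
proof -
  interpret group G by fact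
  have sub: "C \<subseteq> carrier G" if "(H, C) \<in> D_points G" for H C
    using that lcosets_subset_PowG by (auto simp: D_points_def)
  have cl: "(H, g <#\<^bsub>G\<^esub> C) \<in> D_points G" if "g \<in> carrier G" "(H, C) \<in> D_points G" for g H C
  proof -
    from that obtain x where x: "x \<in> carrier G" "C = x <#\<^bsub>G\<^esub> H" and H: "subgroup H G" "H \<noteq> carrier G"
      by (auto simp: D_points_def LCOSETS_def)
    have "g <#\<^bsub>G\<^esub> C = (g \<otimes>\<^bsub>G\<^esub> x) <#\<^bsub>G\<^esub> H"
      using x that H by (simp add: lcos_m_assoc subgroup.subset)
    then show ?thesis using H x that by (auto simp: D_points_def LCOSETS_def)
  qed
  have "group_action G (D_points G) (D_action G)"
  proof (rule group_actionI[OF assms])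
    fix x assume x: "x \<in> D_points G"
    show "D_action G \<one>\<^bsub>G\<^esub> x = x"
      using x sub by (cases x) (auto simp: D_action_def lcos_mult_one)
  next
    fix g h x assume "g \<in> carrier G" "h \<in> carrier G" "x \<in> D_points G"
    then show "D_action G (g \<otimes>\<^bsub>G\<^esub> h) x = D_action G g (D_action G h x)"
      using sub cl by (cases x) (auto simp: D_action_def lcos_m_assoc)
  qed (use cl in \<open>auto simp: D_action_def\<close>)
  moreover from this have "D_action G g \<in> D_points G \<rightarrow> D_points G" if "g \<in> carrier G" for g
    using group_action.element_image that by fastforce
  ultimately show "G_space G (D_space G) (D_action G)"
    by (auto simp: G_space_def D_space_def)
  show "fixed_point_free G (D_space G) (D_action G)"
    unfolding fixed_point_free_def
  proof
    assume "\<exists>p\<in>topspace (D_space G). \<forall>g\<in>carrier G. D_action G g p = p"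
    then obtain H C where p: "(H, C) \<in> D_points G"
      and fx: "\<And>g. g \<in> carrier G \<Longrightarrow> g <#\<^bsub>G\<^esub> C = C"
      by (auto simp: D_space_def D_action_def)
    then obtain x where x: "x \<in> carrier G" "C = x <#\<^bsub>G\<^esub> H" and H: "subgroup H G" "H \<noteq> carrier G"
      by (auto simp: D_points_def LCOSETS_def)
    have HC: "C = H"
      using fx[of "inv\<^bsub>G\<^esub> x"] x H subgroup.subset[OF H(1)]
      by (simp add: lcos_m_assoc lcos_mult_one)
    have "g \<in> H" if g: "g \<in> carrier G" for g
      using fx[OF g] lcos_self[OF g H(1)] HC by auto
    then show False using H subgroup.subset[OF H(1)] by auto
  qed
qed

lemma topspace_W_space:
  assumes e: "bij_betw e {1..q} (carrier G)"
  shows "topspace (W_space G e q k) =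
    {\<phi> \<in> carrier G \<rightarrow>\<^sub>E UNIV. \<not> (\<exists>S c. S \<subseteq> carrier G \<and> card S = k \<and>
        (\<forall>g\<in>S. \<phi> g = c) \<and> (\<forall>h\<in>carrier G. \<phi> h \<le> c))}"
proof -
  have "compose {1..q} \<phi> e \<in> max_diagonal q k \<longleftrightarrow>
    (\<exists>S c. S \<subseteq> carrier G \<and> card S = k \<and> (\<forall>g\<in>S. \<phi> g = c) \<and> (\<forall>h\<in>carrier G. \<phi> h \<le> c))"
    (is "?L \<longleftrightarrow> ?R") for \<phi> :: "_ \<Rightarrow> real"
  proof
    assume ?L
    then obtain S c where S': "S \<subseteq> {1..q}" "card S = k" "\<forall>i\<in>S. compose {1..q} \<phi> e i = c"
      "\<forall>j\<in>{1..q}. compose {1..q} \<phi> e j \<le> c"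
      unfolding max_diagonal_def by blast
    then have S: "S \<subseteq> {1..q}" "card S = k" "\<forall>i\<in>S. \<phi> (e i) = c"
      "\<forall>j\<in>{1..q}. \<phi> (e j) \<le> c"
      by (simp_all add: compose_def subset_iff)
    have "card (e ` S) = k"
      using S(2) card_image[OF inj_on_subset[OF bij_betw_imp_inj_on[OF e] S(1)]] by simp
    moreover have "e ` S \<subseteq> carrier G" "\<forall>h\<in>carrier G. \<phi> h \<le> c"
      using S(1,4) unfolding bij_betw_imp_surj_on[OF e, symmetric] by auto
    ultimately show ?R using S(3) by blast
  next
    assume ?R
    then obtain S c where S: "S \<subseteq> carrier G" "card S = k" "\<forall>g\<in>S. \<phi> g = c"
      "\<forall>h\<in>carrier G. \<phi> h \<le> c" by blast
    define T where "T = {i \<in> {1..q}. e i \<in> S}"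
    have "S \<subseteq> e ` T"
    proof
      fix x assume x: "x \<in> S"
      then have "x \<in> e ` {1..q}" using S(1) bij_betw_imp_surj_on[OF e] by auto
      then obtain i where "i \<in> {1..q}" "x = e i" by (rule imageE)
      then show "x \<in> e ` T" using x by (auto simp: T_def)
    qed
    then have "e ` T = S" by (auto simp: T_def)
    moreover have "inj_on e T"
      by (rule inj_on_subset[OF bij_betw_imp_inj_on[OF e]]) (auto simp: T_def)
    ultimately have "card T = k" using S(2) card_image[of e T] by simp
    moreover have "T \<subseteq> {1..q}" "\<forall>i\<in>T. compose {1..q} \<phi> e i = c"
      using S(3) by (auto simp: T_def compose_def)
    moreover have "\<forall>j\<in>{1..q}. compose {1..q} \<phi> e j \<le> c"
      using S(4) bij_betw_apply[OF e] by (simp add: compose_def)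
    moreover have "compose {1..q} \<phi> e \<in> {1..q} \<rightarrow>\<^sub>E UNIV"
      by (auto simp: compose_def)
    ultimately show ?L unfolding max_diagonal_def by blast
  qed
  moreover have "compose {1..q} \<phi> e \<in> {1..q} \<rightarrow>\<^sub>E UNIV" for \<phi> :: "_ \<Rightarrow> real"
    by (auto simp: compose_def)
  ultimately show ?thesis
    unfolding W_space_def W_def by auto
qed

lemma W_G_space:
  assumes "group G" and e: "bij_betw e {1..q} (carrier G)" and k: "k \<le> q"
  shows "G_space G (W_space G e q k) (W_action G e q k)"
    "fixed_point_free G (W_space G e q k) (W_action G e q k)"
proof -
  interpret group G by fact
  define E where "E = topspace (W_space G e q k)"
  have ext: "\<phi> \<in> extensional (carrier G)" if "\<phi> \<in> E" for \<phi>
    using that by (auto simp: E_def topspace_W_space[OF e] PiE_def)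
  have cl: "Map_action G E g \<phi> \<in> E" if g: "g \<in> carrier G" and \<phi>: "\<phi> \<in> E" for g \<phi>
  proof (rule ccontr)
    assume "Map_action G E g \<phi> \<notin> E"
    moreover have "Map_action G E g \<phi> \<in> carrier G \<rightarrow>\<^sub>E UNIV"
      using \<phi> by (auto simp: Map_action_def)
    ultimately obtain S c where S': "S \<subseteq> carrier G" "card S = k"
      "\<forall>h\<in>S. Map_action G E g \<phi> h = c" "\<forall>h\<in>carrier G. Map_action G E g \<phi> h \<le> c"
      unfolding E_def topspace_W_space[OF e] by blast
    then have S: "S \<subseteq> carrier G" "card S = k"
      "\<forall>h\<in>S. \<phi> (inv\<^bsub>G\<^esub> g \<otimes>\<^bsub>G\<^esub> h) = c" "\<forall>h\<in>carrier G. \<phi> (inv\<^bsub>G\<^esub> g \<otimes>\<^bsub>G\<^esub> h) \<le> c"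
      using \<phi> by (auto simp: Map_action_def subset_iff)
    let ?S = "(\<lambda>h. inv\<^bsub>G\<^esub> g \<otimes>\<^bsub>G\<^esub> h) ` S"
    have "inj_on (\<lambda>h. inv\<^bsub>G\<^esub> g \<otimes>\<^bsub>G\<^esub> h) S"
      using S g by (auto simp: inj_on_def subset_iff)
    then have "card ?S = k" using S by (simp add: card_image)
    moreover have "?S \<subseteq> carrier G" using S g by auto
    moreover have "\<phi> h \<le> c" if "h \<in> carrier G" for h
      using S(4)[rule_format, of "g \<otimes>\<^bsub>G\<^esub> h"] that g by (simp add: m_assoc[symmetric])
    moreover have "\<forall>h\<in>?S. \<phi> h = c" using S by auto
    ultimately show False using \<phi> unfolding E_def topspace_W_space[OF e] by blast
  qed
  have act: "group_action G E (Map_action G E)"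
  proof (rule group_actionI[OF assms(1)])
    fix \<phi> assume \<phi>: "\<phi> \<in> E"
    show "Map_action G E \<one>\<^bsub>G\<^esub> \<phi> = \<phi>"
      by (rule extensionalityI[of _ "carrier G"]) (use \<phi> ext in \<open>auto simp: Map_action_def\<close>)
  next
    fix g h \<phi> assume g: "g \<in> carrier G" "h \<in> carrier G" and \<phi>: "\<phi> \<in> E"
    show "Map_action G E (g \<otimes>\<^bsub>G\<^esub> h) \<phi> = Map_action G E g (Map_action G E h \<phi>)"
      by (rule extensionalityI[of _ "carrier G"])
        (use g \<phi> cl[OF g(2) \<phi>] in \<open>auto simp: Map_action_def inv_mult_group m_assoc\<close>)
  qed (use cl in \<open>auto simp: Map_action_def\<close>)
  have "continuous_map (W_space G e q k) (W_space G e q k) (Map_action G E g)"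
    if g: "g \<in> carrier G" for g
  proof -
    have "continuous_map (W_space G e q k) (powertop_real (carrier G)) (Map_action G E g)"
      unfolding continuous_map_componentwise
    proof (intro conjI ballI)
      fix h assume h: "h \<in> carrier G"
      have "continuous_map (W_space G e q k) euclideanreal (\<lambda>\<phi>. \<phi> (inv\<^bsub>G\<^esub> g \<otimes>\<^bsub>G\<^esub> h))"
        unfolding W_space_def
        by (intro continuous_map_from_subtopology continuous_map_product_projection) (use g h in auto)
      then show "continuous_map (W_space G e q k) euclideanreal (\<lambda>\<phi>. Map_action G E g \<phi> h)"
        by (rule continuous_map_eq) (use h in \<open>auto simp: Map_action_def E_def\<close>)
    qed (auto simp: Map_action_def E_def)
    moreover have "Map_action G E g ` E \<subseteq> {\<phi>. compose {1..q} \<phi> e \<in> W q k}"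
      using cl[OF g] by (auto simp: E_def W_space_def)
    ultimately show ?thesis
      by (subst (2) W_space_def) (auto simp: continuous_map_in_subtopology E_def)
  qed
  then show "G_space G (W_space G e q k) (W_action G e q k)"
    using act by (simp add: G_space_def E_def)
  show "fixed_point_free G (W_space G e q k) (W_action G e q k)"
    unfolding fixed_point_free_def E_def[symmetric]
  proof
    assume "\<exists>\<phi>\<in>E. \<forall>g\<in>carrier G. Map_action G E g \<phi> = \<phi>"
    then obtain \<phi> where \<phi>: "\<phi> \<in> E" and fx: "\<And>g. g \<in> carrier G \<Longrightarrow> Map_action G E g \<phi> = \<phi>"
      by blast
    have const: "\<phi> g = \<phi> \<one>\<^bsub>G\<^esub>" if g: "g \<in> carrier G" for g
      using fun_cong[OF fx[OF g], of g] g \<phi> by (simp add: Map_action_def)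
    have "card (carrier G) = q" using bij_betw_same_card[OF e] by simp
    then obtain S where "S \<subseteq> carrier G" "card S = k"
      using k obtain_subset_with_card_n by metis
    then have "S \<subseteq> carrier G \<and> card S = k \<and> (\<forall>g\<in>S. \<phi> g = \<phi> \<one>\<^bsub>G\<^esub>) \<and>
        (\<forall>h\<in>carrier G. \<phi> h \<le> \<phi> \<one>\<^bsub>G\<^esub>)"
      using const by (metis order_refl subsetD)
    then show False using \<phi> unfolding E_def topspace_W_space[OF e] by blast
  qed
qed

end

theory Submission
  imports Defs
begin

text \<open>
  A point \<open>\<phi>\<close> of \<open>W(q,k)\<close> attains its maximum at fewer than \<open>k\<close> elements of the group. Let
  \<open>X_i\<close> consist of those \<open>\<phi>\<close> for which the \<open>i\<close> largest values are separated by a gap from the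
  others, that is, for which some \<open>i\<close>-element set \<open>S\<close> of group elements satisfies \<open>\<phi> t < \<phi> s\<close>
  whenever \<open>s\<close> lies in \<open>S\<close> and \<open>t\<close> does not. If \<open>\<phi>\<close> attains its maximum exactly \<open>i\<close> times, then
  the set of maximizers is such an \<open>S\<close>; hence \<open>X_1, ..., X_(k-1)\<close> cover \<open>W(q,k)\<close>.

  For fixed \<open>i\<close> and \<open>\<phi>\<close> there is at most one such \<open>S\<close>, and the strict inequalities are
  finitely many open conditions. So \<open>X_i\<close> is the disjoint union of open pieces labelled by the
  \<open>i\<close>-element subsets of the group, and left translation of functions permutes the pieces as
  left multiplication permutes the labels. Since \<open>0 < i < q\<close>, no label is invariant under the
  whole group, and every set on which a group acts without fixed points maps equivariantly to the
  disjoint union of the proper orbits. Composing, one obtains the required map on \<open>X_i\<close>.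
\<close>

section \<open>Equivariant maps to the disjoint union of the proper orbits\<close>

text \<open>Orbit by orbit: fix a base point \<open>r\<close> in each orbit and send \<open>x\<close> to the coset
  of all group elements that carry \<open>r\<close> to \<open>x\<close>. The base point has to depend on the orbit only,
  so it is chosen as a function of the set \<open>orbit G a x\<close>.\<close>

lemma fixed_point_free_set_to_D_points:
  assumes "group_action G E a"
    and no_fix: "\<And>x. x \<in> E \<Longrightarrow> \<exists>g\<in>carrier G. a g x \<noteq> x"
  obtains F where "\<And>x. x \<in> E \<Longrightarrow> F x \<in> D_points G"
    and "\<And>g x. g \<in> carrier G \<Longrightarrow> x \<in> E \<Longrightarrow> F (a g x) = D_action G g (F x)"
proof -
  interpret group_action G E a by fact
  interpret G: group G using group_hom by (simp add: group_hom_def)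
  define r where "r x = (SOME y. y \<in> orbit G a x)" for x
  define F where "F x = (stabilizer G a (r x), {h \<in> carrier G. a h (r x) = x})" for x
  have r: "r x \<in> orbit G a x" if "x \<in> E" for x
    unfolding r_def by (rule someI[of _ x]) (rule orbit_refl[OF that])
  have rE: "r x \<in> E" if "x \<in> E" for x
    using r[OF that] that element_image by (fastforce simp: orbit_def)
  have r_act: "r (a g x) = r x" if g: "g \<in> carrier G" and x: "x \<in> E" for g x
  proof -
    have gx: "a g x \<in> E" using element_image g x by blast
    have "a h x \<in> orbit G a (a g x)" if h: "h \<in> carrier G" for h
    proof -
      have "a (h \<otimes>\<^bsub>G\<^esub> inv\<^bsub>G\<^esub> g) (a g x) = a (h \<otimes>\<^bsub>G\<^esub> inv\<^bsub>G\<^esub> g \<otimes>\<^bsub>G\<^esub> g) x"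
        using composition_rule[OF x, of "h \<otimes>\<^bsub>G\<^esub> inv\<^bsub>G\<^esub> g" g] g h by simp
      also have "\<dots> = a h x" using g h by (simp add: G.m_assoc)
      finally show ?thesis using g h unfolding orbit_def
        by (metis (mono_tags, lifting) G.inv_closed G.m_closed mem_Collect_eq)
    qed
    moreover have "a h (a g x) \<in> orbit G a x" if h: "h \<in> carrier G" for h
      using composition_rule[OF x h g] g h by (auto simp: orbit_def intro!: exI[of _ "h \<otimes>\<^bsub>G\<^esub> g"])
    ultimately have "orbit G a (a g x) = orbit G a x" by (auto simp: orbit_def)
    then show ?thesis by (simp add: r_def)
  qed
  have coset: "{h \<in> carrier G. a h y = a g y} = g <#\<^bsub>G\<^esub> stabilizer G a y"
    if g: "g \<in> carrier G" and y: "y \<in> E" for g y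
  proof (intro equalityI subsetI)
    fix h assume "h \<in> {h \<in> carrier G. a h y = a g y}"
    then have h: "h \<in> carrier G" "a h y = a g y" by auto
    have "a (inv\<^bsub>G\<^esub> g \<otimes>\<^bsub>G\<^esub> h) y = a (inv\<^bsub>G\<^esub> g \<otimes>\<^bsub>G\<^esub> g) y"
      using composition_rule[OF y, of "inv\<^bsub>G\<^esub> g" h]
        composition_rule[OF y, of "inv\<^bsub>G\<^esub> g" g] g h by (simp del: G.l_inv)
    then have "a (inv\<^bsub>G\<^esub> g \<otimes>\<^bsub>G\<^esub> h) y = y" using g y id_eq_one by (metis G.l_inv restrict_apply')
    then have "inv\<^bsub>G\<^esub> g \<otimes>\<^bsub>G\<^esub> h \<in> stabilizer G a y" using g h by (simp add: stabilizer_def)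
    moreover have "h = g \<otimes>\<^bsub>G\<^esub> (inv\<^bsub>G\<^esub> g \<otimes>\<^bsub>G\<^esub> h)" using g h by (simp add: G.m_assoc[symmetric])
    ultimately show "h \<in> g <#\<^bsub>G\<^esub> stabilizer G a y" unfolding l_coset_def by blast
  next
    fix h assume "h \<in> g <#\<^bsub>G\<^esub> stabilizer G a y"
    then show "h \<in> {h \<in> carrier G. a h y = a g y}"
      using composition_rule[OF y g] g by (auto simp: l_coset_def stabilizer_def)
  qed
  have F_eq: "\<exists>h\<in>carrier G. x = a h (r x) \<and> F x = (stabilizer G a (r x), h <#\<^bsub>G\<^esub> stabilizer G a (r x))"
    if x: "x \<in> E" for x
  proof -
    obtain h where h: "h \<in> carrier G" "a h (r x) = x"
      using orbit_sym[OF x rE[OF x] r[OF x]] by (auto simp: orbit_def)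
    then show ?thesis using coset[OF h(1) rE[OF x]] by (intro bexI[of _ h]) (auto simp: F_def)
  qed
  have stab: "subgroup (stabilizer G a y) G" "stabilizer G a y \<noteq> carrier G" if "y \<in> E" for y
    using stabilizer_subgroup[OF that] no_fix[OF that] by (auto simp: stabilizer_def)
  have F_in: "F x \<in> D_points G" if "x \<in> E" for x
    using F_eq[OF that] stab[OF rE[OF that]] by (auto simp: D_points_def LCOSETS_def)
  show thesis
  proof (rule that[OF F_in])
    fix g x assume g: "g \<in> carrier G" and x: "x \<in> E"
    obtain h where h: "h \<in> carrier G" "x = a h (r x)"
      "F x = (stabilizer G a (r x), h <#\<^bsub>G\<^esub> stabilizer G a (r x))"
      using F_eq[OF x] by blast
    have gx: "a g x = a (g \<otimes>\<^bsub>G\<^esub> h) (r x)"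
      using composition_rule[OF rE[OF x] g h(1)] h(2) by simp
    have "F (a g x) = (stabilizer G a (r x), (g \<otimes>\<^bsub>G\<^esub> h) <#\<^bsub>G\<^esub> stabilizer G a (r x))"
      using coset[of "g \<otimes>\<^bsub>G\<^esub> h", OF _ rE[OF x]] g h(1)
      by (simp add: F_def r_act[OF g x] gx[symmetric] del: prod.inject)
    also have "\<dots> = D_action G g (F x)"
      using F_in[OF x] h(3) g h(1) subgroup.subset[OF stab(1)[OF rE[OF x]]]
      by (simp add: D_action_def G.lcos_m_assoc)
    finally show "F (a g x) = D_action G g (F x)" .
  qed
qed

text \<open>Because the pieces are open and disjoint, the map that sends a point to the label of its
  piece is locally constant, hence continuous for every discrete topology on its values. It is
  equivariant, and stays so when followed by an equivariant map from the labels to the proper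
  orbits.\<close>

lemma equivariant_map_of_labelled_pieces:
  assumes act: "group_action G E b"
    and no_fix: "\<And>s. s \<in> E \<Longrightarrow> \<exists>g\<in>carrier G. b g s \<noteq> s"
    and op: "\<And>s. s \<in> E \<Longrightarrow> openin X (P s)"
    and disj: "\<And>s t x. s \<in> E \<Longrightarrow> t \<in> E \<Longrightarrow> x \<in> P s \<Longrightarrow> x \<in> P t \<Longrightarrow> s = t"
    and permute: "\<And>g s x. g \<in> carrier G \<Longrightarrow> s \<in> E \<Longrightarrow> x \<in> P s \<Longrightarrow> a g x \<in> P (b g s)"
  shows "openin X (\<Union>s\<in>E. P s)" "G_invariant G a (\<Union>s\<in>E. P s)"
    "\<exists>f. equivariant_map G (subtopology X (\<Union>s\<in>E. P s)) a (D_space G) (D_action G) f"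
proof -
  interpret group_action G E b by fact
  have bE: "b g s \<in> E" if "g \<in> carrier G" "s \<in> E" for g s
    using element_image that by blast
  show U: "openin X (\<Union>s\<in>E. P s)" using op by blast
  show "G_invariant G a (\<Union>s\<in>E. P s)"
    unfolding G_invariant_def using permute bE by blast
  obtain F where F: "\<And>s. s \<in> E \<Longrightarrow> F s \<in> D_points G"
      "\<And>g s. g \<in> carrier G \<Longrightarrow> s \<in> E \<Longrightarrow> F (b g s) = D_action G g (F s)"
    using fixed_point_free_set_to_D_points[OF act no_fix] by metis
  define label where "label x = (THE s. s \<in> E \<and> x \<in> P s)" for x
  have label: "label x = s" if "s \<in> E" "x \<in> P s" for x s
    unfolding label_def using that disj by blast
  let ?Y = "subtopology X (\<Union>s\<in>E. P s)"
  have top: "topspace ?Y = (\<Union>s\<in>E. P s)"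
    using openin_subset[OF U] by (auto simp: topspace_subtopology)
  have "continuous_map ?Y (D_space G) (F \<circ> label)"
    unfolding continuous_map_def
  proof (intro conjI allI impI)
    show "F \<circ> label \<in> topspace ?Y \<rightarrow> topspace (D_space G)"
      using label F(1) by (auto simp: top D_space_def)
    fix A
    have "{x \<in> topspace ?Y. (F \<circ> label) x \<in> A} = (\<Union>s\<in>{s \<in> E. F s \<in> A}. P s)"
      using label by (auto simp del: topspace_subtopology simp: top)
    moreover have "openin X (\<Union>s\<in>{s \<in> E. F s \<in> A}. P s)" using op by blast
    ultimately show "openin ?Y {x \<in> topspace ?Y. (F \<circ> label) x \<in> A}"
      by (auto simp: openin_open_subtopology[OF U])
  qed
  moreover have "(F \<circ> label) (a g x) = D_action G g ((F \<circ> label) x)"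
    if g: "g \<in> carrier G" and x: "x \<in> topspace ?Y" for g x
  proof -
    obtain s where s: "s \<in> E" "x \<in> P s" using x unfolding top by blast
    then have "label (a g x) = b g s" using label bE permute g by blast
    then show ?thesis using s label F(2) g by simp
  qed
  ultimately show "\<exists>f. equivariant_map G ?Y a (D_space G) (D_action G) f"
    unfolding equivariant_map_def by blast
qed


section \<open>Subsets of a fixed size under left multiplication\<close>

definition subsets_action :: "('g, 'm) monoid_scheme \<Rightarrow> nat \<Rightarrow> 'g \<Rightarrow> 'g set \<Rightarrow> 'g set" where
  "subsets_action G i = (\<lambda>g. \<lambda>S \<in> {S. S \<subseteq> carrier G \<and> card S = i}. g <#\<^bsub>G\<^esub> S)"

lemma subsets_action_group_action:
  assumes "group G"
  shows "group_action G {S. S \<subseteq> carrier G \<and> card S = i} (subsets_action G i)"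
proof -
  interpret group G by fact
  have cl: "g <#\<^bsub>G\<^esub> S \<subseteq> carrier G \<and> card (g <#\<^bsub>G\<^esub> S) = card S"
    if "g \<in> carrier G" "S \<subseteq> carrier G" for g S
  proof -
    have "inj_on ((\<otimes>\<^bsub>G\<^esub>) g) S" using that by (auto simp: inj_on_def subset_iff)
    moreover have "g <#\<^bsub>G\<^esub> S = (\<otimes>\<^bsub>G\<^esub>) g ` S" by (auto simp: l_coset_def)
    ultimately show ?thesis using that by (auto simp: card_image)
  qed
  show ?thesis
  proof (rule group_actionI[OF assms])
    fix g h S assume "g \<in> carrier G" "h \<in> carrier G" "S \<in> {S. S \<subseteq> carrier G \<and> card S = i}"
    then show "subsets_action G i (g \<otimes>\<^bsub>G\<^esub> h) S = subsets_action G i g (subsets_action G i h S)"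
      using cl[of h S] by (simp add: subsets_action_def lcos_m_assoc)
  next
    fix g S assume "g \<in> carrier G" "S \<in> {S. S \<subseteq> carrier G \<and> card S = i}"
    then show "subsets_action G i g S \<in> {S. S \<subseteq> carrier G \<and> card S = i}"
      using cl[of g S] by (simp add: subsets_action_def)
  qed (simp_all add: subsets_action_def lcos_mult_one)
qed

text \<open>Left multiplication is transitive, so an invariant set is empty or everything.\<close>

lemma subsets_action_no_fixed_point:
  assumes "group G" "0 < i" "i < order G"
    and S: "S \<in> {S. S \<subseteq> carrier G \<and> card S = i}"
  shows "\<exists>g\<in>carrier G. subsets_action G i g S \<noteq> S"
proof -
  interpret group G by fact
  obtain s where s: "s \<in> S" using S \<open>0 < i\<close> by (cases "S = {}") auto
  have sG: "s \<in> carrier G" using s S by auto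
  have "S \<noteq> carrier G" using S \<open>i < order G\<close> by (auto simp: order_def)
  then obtain t where t: "t \<in> carrier G" "t \<notin> S" using S by blast
  have "(t \<otimes>\<^bsub>G\<^esub> inv\<^bsub>G\<^esub> s) \<otimes>\<^bsub>G\<^esub> s = t" using t sG by (simp add: m_assoc)
  then have "t \<in> (t \<otimes>\<^bsub>G\<^esub> inv\<^bsub>G\<^esub> s) <#\<^bsub>G\<^esub> S"
    unfolding l_coset_def using s by blast
  then have "subsets_action G i (t \<otimes>\<^bsub>G\<^esub> inv\<^bsub>G\<^esub> s) S \<noteq> S"
    using t(2) S unfolding subsets_action_def by (metis (no_types, lifting) restrict_apply')
  then show ?thesis using t(1) sG by blast
qed


section \<open>Functions whose largest values sit on a given set\<close>

definition top_piece :: "('a \<Rightarrow> real) topology \<Rightarrow> 'a set \<Rightarrow> 'a set \<Rightarrow> ('a \<Rightarrow> real) set" where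
  "top_piece X A S = {\<phi> \<in> topspace X. \<forall>s\<in>S. \<forall>t\<in>A - S. \<phi> t < \<phi> s}"

lemma openin_top_piece:
  assumes "finite A" "S \<subseteq> A"
  shows "openin (subtopology (powertop_real A) V) (top_piece (subtopology (powertop_real A) V) A S)"
proof -
  let ?X = "subtopology (powertop_real A) V"
  have "finite S" using assms finite_subset by blast
  have less: "openin ?X {\<phi> \<in> topspace ?X. \<phi> t < \<phi> s}" if "s \<in> A" "t \<in> A" for s t
  proof -
    have "continuous_map ?X euclideanreal (\<lambda>\<phi>. \<phi> s - \<phi> t)"
      by (intro continuous_map_diff continuous_map_from_subtopology
          continuous_map_product_projection that)
    from openin_continuous_map_preimage[OF this, of "{0<..}"]
    show ?thesis by simp
  qed
  have "top_piece ?X A S =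
      topspace ?X \<inter> (\<Inter>p\<in>S \<times> (A - S). {\<phi> \<in> topspace ?X. \<phi> (snd p) < \<phi> (fst p)})"
    by (auto simp: top_piece_def)
  moreover have "openin ?X \<dots>"
  proof (rule openin_Int_Inter[OF _ openin_topspace])
    show "finite ((\<lambda>p. {\<phi> \<in> topspace ?X. \<phi> (snd p) < \<phi> (fst p)}) ` (S \<times> (A - S)))"
      using assms(1) \<open>finite S\<close> by simp
  qed (use assms(2) less in \<open>auto simp del: topspace_subtopology\<close>)
  ultimately show ?thesis by simp
qed

text \<open>Two different sets of equal finite size each contain an element outside the other, and
  either of the two values would have to be the larger one.\<close>

lemma top_piece_unique:
  assumes "finite A" "S \<subseteq> A" "T \<subseteq> A" "card S = card T"
    and "\<phi> \<in> top_piece X A S" "\<phi> \<in> top_piece X A T"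
  shows "S = T"
proof (rule ccontr)
  assume "S \<noteq> T"
  have "finite S" "finite T" using assms finite_subset by blast+
  then obtain s t where "s \<in> S - T" "t \<in> T - S"
    using card_subset_eq \<open>S \<noteq> T\<close> assms(4) by (metis Diff_iff subsetI)
  then have "\<phi> t < \<phi> s" "\<phi> s < \<phi> t" using assms by (auto simp: top_piece_def)
  then show False by simp
qed

text \<open>Translating a function by \<open>g\<close> replaces the argument \<open>h\<close> by \<open>inv g \<otimes> h\<close>, so the
  large values move from \<open>S\<close> to \<open>g S\<close>.\<close>

lemma Map_action_top_piece:
  assumes "group G" and g: "g \<in> carrier G" and S: "S \<subseteq> carrier G"
    and \<phi>: "\<phi> \<in> top_piece X (carrier G) S"
    and closed: "Map_action G (topspace X) g \<phi> \<in> topspace X"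
  shows "Map_action G (topspace X) g \<phi> \<in> top_piece X (carrier G) (g <#\<^bsub>G\<^esub> S)"
proof -
  interpret group G by fact
  have "Map_action G (topspace X) g \<phi> t < Map_action G (topspace X) g \<phi> s"
    if s: "s \<in> g <#\<^bsub>G\<^esub> S" and t: "t \<in> carrier G - (g <#\<^bsub>G\<^esub> S)" for s t
  proof -
    obtain s' where s': "s' \<in> S" "s = g \<otimes>\<^bsub>G\<^esub> s'" using s by (auto simp: l_coset_def)
    have s'G: "s' \<in> carrier G" using s' S by auto
    have inv_s: "inv\<^bsub>G\<^esub> g \<otimes>\<^bsub>G\<^esub> s = s'" using s' s'G g by (simp add: m_assoc[symmetric])
    have "t = g \<otimes>\<^bsub>G\<^esub> (inv\<^bsub>G\<^esub> g \<otimes>\<^bsub>G\<^esub> t)" using t g by (simp add: m_assoc[symmetric])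
    then have "inv\<^bsub>G\<^esub> g \<otimes>\<^bsub>G\<^esub> t \<notin> S" using t unfolding l_coset_def by blast
    then have "\<phi> (inv\<^bsub>G\<^esub> g \<otimes>\<^bsub>G\<^esub> t) < \<phi> s'"
      using \<phi> s' t g by (auto simp: top_piece_def)
    then show ?thesis
      using \<phi> t s' s'G g inv_s by (simp add: Map_action_def top_piece_def)
  qed
  then show ?thesis using closed by (auto simp: top_piece_def)
qed

text \<open>The set of maximizers of \<open>\<phi>\<close> has fewer than \<open>k\<close> elements, for otherwise \<open>k\<close> of them
  would witness that \<open>\<phi>\<close> lies in the diagonal.\<close>

lemma W_space_in_top_piece:
  assumes fin: "finite (carrier G)" and ne: "carrier G \<noteq> {}"
    and e: "bij_betw e {1..q} (carrier G)"
    and \<phi>: "\<phi> \<in> topspace (W_space G e q k)"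
  obtains S where "S \<subseteq> carrier G" "card S \<in> {1..k - 1}"
    "\<phi> \<in> top_piece (W_space G e q k) (carrier G) S"
proof
  define c where "c = Max (\<phi> ` carrier G)"
  define S where "S = {g \<in> carrier G. \<phi> g = c}"
  have le: "\<phi> h \<le> c" if "h \<in> carrier G" for h using that fin by (simp add: c_def)
  have "c \<in> \<phi> ` carrier G" unfolding c_def using fin ne by (intro Max_in) auto
  then have "S \<noteq> {}" by (auto simp: S_def)
  show S: "S \<subseteq> carrier G" by (auto simp: S_def)
  have "card S < k"
  proof (rule ccontr)
    assume "\<not> card S < k"
    then obtain T where "T \<subseteq> S" "card T = k"
      using obtain_subset_with_card_n by (metis not_less)
    then have "T \<subseteq> carrier G \<and> card T = k \<and> (\<forall>g\<in>T. \<phi> g = c) \<and> (\<forall>h\<in>carrier G. \<phi> h \<le> c)"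
      using le by (auto simp: S_def)
    then show False using \<phi> unfolding topspace_W_space[OF e] by blast
  qed
  moreover have "0 < card S" using \<open>S \<noteq> {}\<close> S fin by (simp add: card_gt_0_iff finite_subset)
  ultimately show "card S \<in> {1..k - 1}" by auto
  show "\<phi> \<in> top_piece (W_space G e q k) (carrier G) S"
    using \<phi> le by (fastforce simp: top_piece_def S_def order_less_le)
qed


section \<open>The bound on the genus\<close>

theorem theorem5p1:
  fixes G :: "('g, 'm) monoid_scheme" and e :: "nat \<Rightarrow> 'g" and q k :: nat
  assumes "group G" and "finite (carrier G)" and "q = order G"
    and "bij_betw e {1..q} (carrier G)"
    and "2 \<le> k" and "k \<le> q"
  shows "fpf_genus G (W_space G e q k) (W_action G e q k) \<le> enat (k - 1)"
proof -
  interpret G: group G by fact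
  let ?X = "W_space G e q k" and ?a = "W_action G e q k"
  interpret W: group_action G "topspace ?X" ?a
    using W_G_space(1)[OF assms(1,4,6)] by (simp add: G_space_def)
  define E where "E i = {S. S \<subseteq> carrier G \<and> card S = i}" for i
  define P where "P = top_piece ?X (carrier G)"
  have piece:
    "openin ?X (\<Union>S\<in>E i. P S)" "G_invariant G ?a (\<Union>S\<in>E i. P S)"
    "\<exists>f. equivariant_map G (subtopology ?X (\<Union>S\<in>E i. P S)) ?a (D_space G) (D_action G) f"
    if i: "i \<in> {1..k - 1}" for i
  proof -
    have act: "group_action G (E i) (subsets_action G i)"
      unfolding E_def by (rule subsets_action_group_action[OF assms(1)])
    have no_fix: "\<exists>g\<in>carrier G. subsets_action G i g S \<noteq> S" if "S \<in> E i" for S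
      by (rule subsets_action_no_fixed_point[OF assms(1)]) (use i assms that in \<open>auto simp: E_def\<close>)
    have op: "openin ?X (P S)" if "S \<in> E i" for S
      using that assms(2) unfolding P_def W_space_def E_def by (intro openin_top_piece) auto
    have disj: "S = T" if "S \<in> E i" "T \<in> E i" "\<phi> \<in> P S" "\<phi> \<in> P T" for S T \<phi>
      by (rule top_piece_unique[OF assms(2)]) (use that in \<open>auto simp: E_def P_def\<close>)
    have permute: "?a g \<phi> \<in> P (subsets_action G i g S)"
      if g: "g \<in> carrier G" and S: "S \<in> E i" and \<phi>: "\<phi> \<in> P S" for g S \<phi>
    proof -
      have "?a g \<phi> \<in> topspace ?X"
        using W.element_image[OF g] \<phi> by (auto simp: P_def top_piece_def)
      then have "?a g \<phi> \<in> P (g <#\<^bsub>G\<^esub> S)"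
        using Map_action_top_piece[OF assms(1) g] S \<phi> unfolding P_def E_def by blast
      then show ?thesis using S by (simp add: subsets_action_def E_def)
    qed
    note labelled = equivariant_map_of_labelled_pieces[OF act, of ?X P ?a]
    show "openin ?X (\<Union>S\<in>E i. P S)"
      by (rule labelled(1)) (fact no_fix op disj permute)+
    show "G_invariant G ?a (\<Union>S\<in>E i. P S)"
      by (rule labelled(2)) (fact no_fix op disj permute)+
    show "\<exists>f. equivariant_map G (subtopology ?X (\<Union>S\<in>E i. P S)) ?a (D_space G) (D_action G) f"
      by (rule labelled(3)) (fact no_fix op disj permute)+
  qed
  have "(\<Union>i\<in>{1..k - 1}. \<Union>S\<in>E i. P S) = topspace ?X"
  proof (intro equalityI subsetI)
    fix \<phi> assume "\<phi> \<in> topspace ?X"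
    then obtain S where "S \<subseteq> carrier G" "card S \<in> {1..k - 1}" "\<phi> \<in> P S"
      using W_space_in_top_piece[OF assms(2) G.carrier_not_empty assms(4)] unfolding P_def by metis
    then show "\<phi> \<in> (\<Union>i\<in>{1..k - 1}. \<Union>S\<in>E i. P S)"
      unfolding E_def by blast
  qed (auto simp: P_def top_piece_def)
  then have "genus_cover G ?X ?a (k - 1)"
    unfolding genus_cover_def
    by (intro exI[of _ "\<lambda>i. \<Union>S\<in>E i. P S"] conjI ballI piece)
  then show ?thesis
    unfolding fpf_genus_def by (intro Inf_lower) blast
qed

end
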